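(* Let $m\ge 1$ be a fixed integer, let $G\sim\mathcal{PA}(m;n)$, and let $\sigma$ be a uniformly random permutation from the symmetric group $\mathbb{S}_n$, independent of $G$. Then $$H(G) - H(S(G)) = H(\sigma \mid \sigma(G)) - \mathbb{E}[\log|\mathrm{Aut}(G)|].$$
   Context: Preferential attachment model: for an integer $m\ge 1$, $\mathcal{PA}(m;n)$ is the distribution of the random multigraph $G_n$ on vertex set $[n]=\{1,\dots,n\}$ built recursively as follows. $G_1$ is the single vertex $1$ with $m$ self-loops (these are the only self-loops in the graph, and each is counted once in the degree of vertex $1$). Given $G_n$, add vertex $n+1$ and let it make $m$ random choices $v_1,\dots,v_m\in[n]$ of neighbors with $$P(v_i = w \mid G_n, v_1,\dots,v_{i-1}) = \frac{\deg_n(w)}{\sum_{u\in[n]}\deg_n(u)} = \frac{\deg_n(w)}{2mn-m},\qquad w\in[n],$$ where $\deg_n(w)$ is the degree of $w$ in $G_n$ (multiplicities counted); one edge joins $n+1$ to each $v_i$, so multiple edges may occur. The result is $G_{n+1}\sim\mathcal{PA}(m;n+1)$. $S(G)$ denotes the structure (isomorphism class, i.e. unlabeled version) of the labeled multigraph $G$. For a permutation $\pi$ of $[n]$, $\pi(G)$ is the multigraph obtained by relabeling each vertex $v$ of $G$ as $\pi(v)$. $\mathrm{Aut}(G)$ is the group of permutations of the vertex set preserving the number of edges between every pair of vertices. $H(\cdot)$ and $H(\cdot\mid\cdot)$ denote Shannon entropy and conditional Shannon entropy (of random variables), e.g. $H(G) = -\sum_g P(G=g)\log P(G=g)$, with the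 same base of logarithm throughout. *)

theory Defs
  imports "HOL-Probability.Probability" "HOL-Library.Uprod" "HOL-Combinatorics.Permutations"
begin

text \<open>
  A labeled multigraph on the vertex set \<open>{1..n}\<close> is given by its multiset of edges, an edge being an
  unordered pair of (possibly equal) vertices; \<open>n\<close> is passed separately where it matters.
\<close>

type_synonym multigraph = "nat uprod multiset"

text \<open>A self-loop is a single edge incident to its vertex, so it contributes 1 to the degree.\<close>

definition deg :: "multigraph \<Rightarrow> nat \<Rightarrow> nat" where
  "deg G v = size {#e \<in># G. v \<in> set_uprod e#}"

definition choice_pmf :: "nat \<Rightarrow> multigraph \<Rightarrow> nat pmf" where
  "choice_pmf n G =
     embed_pmf (\<lambda>w. if w \<in> {1..n} then real (deg G w) / (\<Sum>u\<in>{1..n}. real (deg G u)) else 0)"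

text \<open>
  All \<open>m\<close> choices of the new vertex use the degrees in the old graph, hence they are independent
  given that graph. The clause for
  \<open>n = 0\<close> is a dummy.
\<close>

fun PA :: "nat \<Rightarrow> nat \<Rightarrow> multigraph pmf" where
  "PA m 0 = return_pmf {#}"
| "PA m (Suc 0) = return_pmf (replicate_mset m (Upair 1 1))"
| "PA m (Suc (Suc n)) = do {
     G \<leftarrow> PA m (Suc n);
     vs \<leftarrow> replicate_pmf m (choice_pmf (Suc n) G);
     return_pmf (G + image_mset (\<lambda>v. Upair (Suc (Suc n)) v) (mset vs))
   }"

definition relabel :: "(nat \<Rightarrow> nat) \<Rightarrow> multigraph \<Rightarrow> multigraph" where
  "relabel \<pi> G = image_mset (map_uprod \<pi>) G"

definition perms :: "nat \<Rightarrow> (nat \<Rightarrow> nat) set" where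
  "perms n = {\<pi>. \<pi> permutes {1..n}}"

text \<open>The structure of \<open>G\<close>: the set of all multigraphs on \<open>{1..n}\<close> isomorphic to \<open>G\<close>.\<close>

definition struct :: "nat \<Rightarrow> multigraph \<Rightarrow> multigraph set" where
  "struct n G = {relabel \<pi> G | \<pi>. \<pi> \<in> perms n}"

definition Aut :: "nat \<Rightarrow> multigraph \<Rightarrow> (nat \<Rightarrow> nat) set" where
  "Aut n G = {\<pi> \<in> perms n. \<forall>u\<in>{1..n}. \<forall>v\<in>{1..n}.
                count G (Upair (\<pi> u) (\<pi> v)) = count G (Upair u v)}"

text \<open>The function embedded in \<open>choice_pmf\<close> is a probability mass function whenever \<open>G\<close> has an edge.\<close>

lemma pmf_choice_pmf:
  assumes "(\<Sum>u\<in>{1..n}. deg G u) > 0"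
  shows "pmf (choice_pmf n G) w =
           (if w \<in> {1..n} then real (deg G w) / (\<Sum>u\<in>{1..n}. real (deg G u)) else 0)"
  unfolding choice_pmf_def
proof (rule pmf_embed_pmf)
  let ?D = "\<Sum>u\<in>{1..n}. real (deg G u)"
  let ?f = "\<lambda>w. if w \<in> {1..n} then real (deg G w) / ?D else 0"
  have D: "?D > 0" using assms by (simp flip: of_nat_sum)
  then show "0 \<le> ?f x" for x by simp
  have "(\<integral>\<^sup>+ x. ennreal (?f x) \<partial>count_space UNIV) = (\<Sum>x\<in>{1..n}. ennreal (?f x))"
    by (rule nn_integral_count_space') auto
  also have "\<dots> = ennreal (\<Sum>x\<in>{1..n}. ?f x)"
    using D by (intro sum_ennreal) simp
  also have "(\<Sum>x\<in>{1..n}. ?f x) = 1"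
    using D by (simp flip: sum_divide_distrib)
  finally show "(\<integral>\<^sup>+ x. ennreal (?f x) \<partial>count_space UNIV) = 1" by simp
qed

lemma deg_add: "deg (G + H) v = deg G v + deg H v"
  by (simp add: deg_def)

lemma sum_deg_new_edges:
  assumes "set vs \<subseteq> {1..n}"
  shows "(\<Sum>u\<in>{1..Suc n}. deg (image_mset (\<lambda>v. Upair (Suc n) v) (mset vs)) u) = 2 * length vs"
  using assms
proof (induction vs)
  case Nil
  then show ?case by (simp add: deg_def)
next
  case (Cons a vs)
  have "deg (image_mset (\<lambda>v. Upair (Suc n) v) (mset (a # vs))) u
          = deg (image_mset (\<lambda>v. Upair (Suc n) v) (mset vs)) u
            + ((if u = Suc n then 1 else 0) + (if u = a then 1 else 0))" if "u \<in> {1..Suc n}" for u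
    using Cons.prems that by (auto simp: deg_def)
  then have "(\<Sum>u\<in>{1..Suc n}. deg (image_mset (\<lambda>v. Upair (Suc n) v) (mset (a # vs))) u)
          = (\<Sum>u\<in>{1..Suc n}. deg (image_mset (\<lambda>v. Upair (Suc n) v) (mset vs)) u
            + ((if u = Suc n then 1 else 0) + (if u = a then 1 else 0)))"
    by (intro sum.cong refl)
  then show ?case
    using Cons by (simp add: sum.distrib del: sum.cl_ivl_Suc)
qed

text \<open>The normalizing constant in \<open>choice_pmf\<close> is \<open>2 * m * n - m\<close> along the process.\<close>

lemma PA_support:
  assumes "m \<ge> 1" "n \<ge> 1" "G \<in> set_pmf (PA m n)"
  shows "(\<forall>e\<in>#G. set_uprod e \<subseteq> {1..n}) \<and> (\<Sum>u\<in>{1..n}. deg G u) = 2 * m * n - m"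
  using assms
proof (induction m n arbitrary: G rule: PA.induct)
  case (1 m)
  then show ?case by simp
next
  case (2 m)
  have "size {#e \<in># replicate_mset m (Upair (Suc 0) (Suc 0)). Suc 0 \<in> set_uprod e#} = m"
    by (induction m) auto
  then show ?case using 2 by (auto simp: deg_def)
next
  case (3 m n)
  let ?E = "\<lambda>vs. image_mset (\<lambda>v. Upair (Suc (Suc n)) v) (mset vs)"
  from "3.prems" obtain G0 vs where G0: "G0 \<in> set_pmf (PA m (Suc n))"
    and vs: "vs \<in> set_pmf (replicate_pmf m (choice_pmf (Suc n) G0))"
    and G: "G = G0 + ?E vs"
    by auto
  have IH: "\<forall>e\<in>#G0. set_uprod e \<subseteq> {1..Suc n}"
      "(\<Sum>u\<in>{1..Suc n}. deg G0 u) = 2 * m * Suc n - m"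
    using "3.IH"[OF "3.prems"(1) _ G0] by auto
  have "(\<Sum>u\<in>{1..Suc n}. deg G0 u) > 0" using IH(2) "3.prems"(1) by simp
  from pmf_choice_pmf[OF this] have "set_pmf (choice_pmf (Suc n) G0) \<subseteq> {1..Suc n}"
    by (auto simp: set_pmf_iff split: if_splits)
  with vs have vs': "set vs \<subseteq> {1..Suc n}" "length vs = m"
    by (auto simp: set_replicate_pmf)
  have "deg G0 (Suc (Suc n)) = 0"
    using IH(1) by (fastforce simp: deg_def)
  then have "(\<Sum>u\<in>{1..Suc (Suc n)}. deg G u) = 2 * m * Suc n - m + 2 * m"
    unfolding G deg_add sum.distrib sum_deg_new_edges[OF vs'(1)]
    using IH(2) vs'(2) by simp
  moreover have "\<forall>e\<in>#G. set_uprod e \<subseteq> {1..Suc (Suc n)}"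
    using IH(1) vs'(1) unfolding G by fastforce
  ultimately show ?case by simp
qed

end

theory Submission
  imports Defs
begin

text \<open>
  All quantities involved are expectations of logarithms of point probabilities, and the identity
  already holds between the random variables inside the expectations, almost surely. Let \<open>p\<close> be the
  distribution of \<open>G\<close>, and let \<open>G' = \<sigma>(G)\<close>. Up to sign, the entropies \<open>H(G)\<close> and \<open>H(S(G))\<close> are
  the means of \<open>log p(G)\<close> and of \<open>log p(S(G))\<close>, where \<open>p(S)\<close> is the total mass of an isomorphism
  class, and \<open>H(\<sigma> | G')\<close> is the mean of the logarithm of \<open>P(\<sigma>, G') / P(G')\<close>.

  The numerator is easy: knowing \<open>(\<sigma>, G')\<close> is the same as knowing \<open>(\<sigma>, G)\<close>, so by independence it
  is \<open>p(G) / n!\<close>. For the denominator, sum over the permutation that was drawn: \<open>P(G' = h)\<close> is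
  the average of \<open>p\<close> over all relabelings of \<open>h\<close>. The orbit of \<open>h\<close> is its isomorphism class, and each
  member of the orbit is hit by as many permutations as \<open>h\<close> has automorphisms, so that
  \<open>P(G' = h) = |Aut(h)| p(S(h)) / n!\<close> (lemma \<open>sum_pmf_relabel\<close>). Structure and number of
  automorphisms are the same for \<open>G'\<close> and \<open>G\<close>, whence the quotient is
  \<open>p(G) / (|Aut(G)| p(S(G)))\<close>, and its logarithm is \<open>log p(G) - log p(S(G)) - log |Aut(G)|\<close>. The
  expectation may be taken term by term because \<open>G\<close> almost surely takes one of finitely many values.

  Two facts about the preferential attachment model enter: this finiteness (\<open>finite_set_PA\<close>), and
  that all edges lie within \<open>{1..n}\<close>, which makes the automorphism group, defined by edge counts
  between vertices of \<open>{1..n}\<close>, the stabilizer of the graph (\<open>Aut_eq_stabilizer\<close>).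
\<close>

section \<open>Entropy of discrete random variables as an expectation\<close>

text \<open>
  Every measure on a countable discrete space has its point masses as a density. Since counting
  measure has no null sets except the empty one, this density is determined everywhere rather than
  almost everywhere.
\<close>

lemma RN_deriv_count_space:
  assumes "countable S" "sets N = Pow S" "x \<in> S"
  shows "RN_deriv (count_space S) N x = emeasure N {x}"
proof -
  interpret sigma_finite_measure "count_space S"
    using assms(1) by (rule sigma_finite_measure_count_space_countable)
  have "density (count_space S) (\<lambda>x. emeasure N {x}) = N"
  proof (rule measure_eqI_countable[OF _ _ assms(1)])
    fix a assume "a \<in> S"
    then have "emeasure (density (count_space S) (\<lambda>x. emeasure N {x})) {a}
        = (\<integral>\<^sup>+ x. emeasure N {a} * indicator {a} x \<partial>count_space S)"
      by (subst emeasure_density) (auto intro!: nn_integral_cong simp: indicator_def)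
    also have "\<dots> = emeasure N {a}"
      using \<open>a \<in> S\<close> by (subst nn_integral_cmult_indicator) auto
    finally show "emeasure (density (count_space S) (\<lambda>x. emeasure N {x})) {a} = emeasure N {a}" .
  qed (use assms in auto)
  then have "AE y in count_space S. emeasure N {y} = RN_deriv (count_space S) N y"
    by (intro RN_deriv_unique) auto
  with \<open>x \<in> S\<close> show ?thesis by (simp add: AE_count_space)
qed

context prob_space
begin

lemma RN_deriv_distr_count_space:
  assumes "countable S" "X \<in> measurable M (count_space S)" "x \<in> S"
  shows "enn2real (RN_deriv (count_space S) (distr M (count_space S) X) x)
           = prob (X -` {x} \<inter> space M)"
  using assms by (simp add: RN_deriv_count_space emeasure_distr measure_def)

text \<open>
  The defining integral runs over the values of \<open>X\<close>, with respect to the distribution of \<open>X\<close>.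
  Pulling it back to the sample space turns the entropies of different random variables into
  expectations over one space, where they can be compared pointwise.
\<close>

lemma entropy_count_space:
  assumes "countable S" "X \<in> measurable M (count_space S)"
  shows "entropy b (count_space S) X
           = - expectation (\<lambda>\<omega>. log b (prob (X -` {X \<omega>} \<inter> space M)))"
proof -
  have "entropy b (count_space S) X
      = - expectation (\<lambda>\<omega>. log b (enn2real
            (RN_deriv (count_space S) (distr M (count_space S) X) (X \<omega>))))"
    unfolding entropy_def KL_divergence_def entropy_density_def
    using assms(2) by (subst integral_distr) (auto simp: comp_def)
  also have "\<dots> = - expectation (\<lambda>\<omega>. log b (prob (X -` {X \<omega>} \<inter> space M)))"
    using measurable_space[OF assms(2)]
    by (intro arg_cong[where f=uminus] Bochner_Integration.integral_cong refl)
       (simp add: RN_deriv_distr_count_space[OF assms])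
  finally show ?thesis .
qed

lemma conditional_entropy_count_space:
  assumes S: "countable S" "X \<in> measurable M (count_space S)"
    and T: "countable T" "Y \<in> measurable M (count_space T)"
  shows "conditional_entropy b (count_space S) (count_space T) X Y
           = - expectation (\<lambda>\<omega>. log b
                 (prob ((\<lambda>\<omega>'. (X \<omega>', Y \<omega>')) -` {(X \<omega>, Y \<omega>)} \<inter> space M)
                    / prob (Y -` {Y \<omega>} \<inter> space M)))"
proof -
  have pair: "count_space S \<Otimes>\<^sub>M count_space T = count_space (S \<times> T)"
    using S T by (simp add: pair_measure_countable)
  have XY: "(\<lambda>\<omega>. (X \<omega>, Y \<omega>)) \<in> measurable M (count_space (S \<times> T))"
    unfolding pair[symmetric] using S(2) T(2) by (rule measurable_Pair)
  have ST: "countable (S \<times> T)" using S T by simp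
  show ?thesis
    unfolding conditional_entropy_def pair
    using measurable_space[OF S(2)] measurable_space[OF T(2)]
    by (subst integral_distr[OF XY])
       (auto intro!: Bochner_Integration.integral_cong
          simp: RN_deriv_distr_count_space[OF ST XY] RN_deriv_distr_count_space[OF T])
qed

lemma integrable_finite_range_AE:
  fixes f :: "'b \<Rightarrow> real"
  assumes X: "X \<in> measurable M (count_space UNIV)" and "finite K" "AE \<omega> in M. X \<omega> \<in> K"
  shows "integrable M (\<lambda>\<omega>. f (X \<omega>))"
proof (rule integrable_const_bound[where B="\<Sum>x\<in>K. \<bar>f x\<bar>"])
  show "AE \<omega> in M. norm (f (X \<omega>)) \<le> (\<Sum>x\<in>K. \<bar>f x\<bar>)"
    using assms(3) by eventually_elim (auto intro!: member_le_sum assms(2))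
  show "(\<lambda>\<omega>. f (X \<omega>)) \<in> borel_measurable M"
    using X by (rule measurable_compose) simp
qed

end

section \<open>Relabeling as a group action\<close>

text \<open>Countability makes counting measure on all multigraphs \<open>\<sigma>\<close>-finite, hence its
  Radon-Nikodym derivatives meaningful.\<close>

lemma countable_multigraphs: "countable (UNIV :: multigraph set)"
proof -
  have "e \<in> range (\<lambda>(x, y). Upair x y)" for e :: "nat uprod"
    by (cases e) auto
  then have "(UNIV :: nat uprod set) = range (\<lambda>(x, y). Upair x y)" by blast
  then have "countable (UNIV :: nat uprod set)"
    by (metis countable_image countableI_type)
  then have "countable (lists (UNIV :: nat uprod set))" by (rule countable_lists)
  then have "countable (mset ` lists (UNIV :: nat uprod set))" by (rule countable_image)
  moreover have "mset ` lists (UNIV :: nat uprod set) = UNIV"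
    by (metis ex_mset lists_UNIV surjI surj_def)
  ultimately show ?thesis by simp
qed

lemma relabel_id [simp]: "relabel id G = G"
  by (simp add: relabel_def uprod.map_id0)

lemma relabel_comp: "relabel \<pi> (relabel \<rho> G) = relabel (\<pi> \<circ> \<rho>) G"
  by (simp add: relabel_def multiset.map_comp uprod.map_comp comp_def)

lemma perms_inv_comp:
  assumes "\<pi> \<in> perms n"
  shows "inv \<pi> \<circ> \<pi> = id" "\<pi> \<circ> inv \<pi> = id"
  using assms permutes_inv_o[of \<pi> "{1..n}"] by (auto simp: perms_def)

lemma id_in_perms [simp]: "id \<in> perms n"
  by (simp add: perms_def permutes_id)

lemma inv_in_perms: "\<pi> \<in> perms n \<Longrightarrow> inv \<pi> \<in> perms n"
  by (simp add: perms_def permutes_inv)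

lemma comp_in_perms: "\<pi> \<in> perms n \<Longrightarrow> \<rho> \<in> perms n \<Longrightarrow> \<pi> \<circ> \<rho> \<in> perms n"
  by (simp add: perms_def permutes_compose)

lemma finite_perms [simp]: "finite (perms n)"
  by (simp add: perms_def finite_permutations)

lemma card_perms: "card (perms n) = fact n"
  by (simp add: perms_def card_permutations)

lemma relabel_eq_iff:
  assumes "\<pi> \<in> perms n"
  shows "relabel \<pi> G = H \<longleftrightarrow> G = relabel (inv \<pi>) H"
  using perms_inv_comp[OF assms] by (metis relabel_comp relabel_id)

lemma struct_relabel:
  assumes "\<pi> \<in> perms n"
  shows "struct n (relabel \<pi> G) = struct n G"
proof
  show "struct n (relabel \<pi> G) \<subseteq> struct n G"
    unfolding struct_def relabel_comp using comp_in_perms[OF _ assms] by auto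
  show "struct n G \<subseteq> struct n (relabel \<pi> G)"
  proof
    fix H assume "H \<in> struct n G"
    then obtain \<rho> where \<rho>: "\<rho> \<in> perms n" "H = relabel \<rho> G" by (auto simp: struct_def)
    then have "H = relabel (\<rho> \<circ> inv \<pi>) (relabel \<pi> G)"
      using perms_inv_comp[OF assms] by (simp add: relabel_comp o_assoc[symmetric])
    then show "H \<in> struct n (relabel \<pi> G)"
      using comp_in_perms[OF \<rho>(1) inv_in_perms[OF assms]] by (auto simp: struct_def)
  qed
qed

lemma self_in_struct: "G \<in> struct n G"
  using id_in_perms[of n] relabel_id[of G] unfolding struct_def by (smt (verit) mem_Collect_eq)

lemma struct_eq_iff: "struct n H = struct n G \<longleftrightarrow> H \<in> struct n G"
proof
  show "H \<in> struct n G" if "struct n H = struct n G"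
    using self_in_struct[of H n] that by simp
  show "struct n H = struct n G" if H: "H \<in> struct n G"
  proof -
    obtain \<pi> where "\<pi> \<in> perms n" "H = relabel \<pi> G"
      using H by (auto simp: struct_def)
    then show ?thesis by (simp add: struct_relabel)
  qed
qed

text \<open>
  A permutation of \<open>{1..n}\<close> maps unordered pairs injectively, so \<open>relabel \<pi> G\<close> has at \<open>\<pi>(e)\<close> the
  multiplicity that \<open>G\<close> has at \<open>e\<close>. An automorphism therefore fixes the multiplicity of every pair
  within \<open>{1..n}\<close>; the hypothesis takes care of all the other pairs.
\<close>

lemma Aut_eq_stabilizer:
  assumes G: "\<forall>e\<in>#G. set_uprod e \<subseteq> {1..n}"
  shows "Aut n G = {\<pi> \<in> perms n. relabel \<pi> G = G}"
proof -
  have count: "count (relabel \<pi> G) (map_uprod \<pi> e) = count G e" if "\<pi> \<in> perms n" for \<pi> e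
  proof -
    have "inj \<pi>" using that by (auto simp: perms_def permutes_inj)
    then have "inj (map_uprod \<pi>)" by (rule uprod.inj_map)
    then have "map_uprod \<pi> -` {map_uprod \<pi> e} = {e}" by (auto simp: inj_eq)
    then show ?thesis by (cases "e \<in># G") (auto simp: relabel_def count_image_mset not_in_iff)
  qed
  have "relabel \<pi> G = G"
    if \<pi>: "\<pi> \<in> perms n"
      and aut: "\<forall>u\<in>{1..n}. \<forall>v\<in>{1..n}. count G (Upair (\<pi> u) (\<pi> v)) = count G (Upair u v)" for \<pi>
  proof (rule multiset_eqI)
    fix e
    have perm: "\<pi> permutes {1..n}" using \<pi> by (simp add: perms_def)
    obtain x y where e: "e = map_uprod \<pi> (Upair x y)"
      using permutes_surj[OF perm] by (cases e) (metis map_uprod_simps surjD)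
    have "count G (Upair x y) = count G e"
    proof (cases "x \<in> {1..n} \<and> y \<in> {1..n}")
      case True
      then show ?thesis using aut e by simp
    next
      case False
      \<comment> \<open>Neither \<open>e\<close> nor its preimage lies within \<open>{1..n}\<close>, so both have multiplicity 0.\<close>
      then have "\<not> (\<pi> x \<in> {1..n} \<and> \<pi> y \<in> {1..n})"
        using permutes_in_image[OF perm] by blast
      with False have "Upair x y \<notin># G" "e \<notin># G" using G e by (fastforce simp del: atLeastAtMost_iff)+
      then show ?thesis by (simp add: not_in_iff)
    qed
    then show "count (relabel \<pi> G) e = count G e" using count[OF \<pi>] e by metis
  qed
  moreover have "count G (Upair (\<pi> u) (\<pi> v)) = count G (Upair u v)"
    if "\<pi> \<in> perms n" "relabel \<pi> G = G" for \<pi> u v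
    using count[OF that(1), of "Upair u v"] that(2) by simp
  ultimately show ?thesis unfolding Aut_def by blast
qed

text \<open>
  The permutations that carry \<open>G\<close> to \<open>relabel \<rho> G\<close> form a left coset of the stabilizer of \<open>G\<close>.
  They also form a right coset of the stabilizer of \<open>relabel \<rho> G\<close>, so isomorphic graphs have
  stabilizers of the same size.
\<close>

lemma card_transporter:
  assumes \<rho>: "\<rho> \<in> perms n"
  shows "card {\<pi> \<in> perms n. relabel \<pi> G = relabel \<rho> G} = card {\<pi> \<in> perms n. relabel \<pi> G = G}"
proof -
  have "bij_betw (\<lambda>\<pi>. \<rho> \<circ> \<pi>) {\<pi> \<in> perms n. relabel \<pi> G = G}
          {\<pi> \<in> perms n. relabel \<pi> G = relabel \<rho> G}"
    using \<rho> inv_in_perms[OF \<rho>] perms_inv_comp[OF \<rho>]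
    by (intro bij_betwI[where g="\<lambda>\<pi>. inv \<rho> \<circ> \<pi>"])
       (auto simp: comp_in_perms o_assoc simp flip: relabel_comp, auto simp: relabel_comp)
  then show ?thesis by (simp add: bij_betw_same_card)
qed

lemma card_stabilizer_relabel:
  assumes \<rho>: "\<rho> \<in> perms n"
  shows "card {\<pi> \<in> perms n. relabel \<pi> (relabel \<rho> G) = relabel \<rho> G}
           = card {\<pi> \<in> perms n. relabel \<pi> G = G}"
proof -
  have "bij_betw (\<lambda>\<pi>. \<pi> \<circ> \<rho>) {\<pi> \<in> perms n. relabel \<pi> (relabel \<rho> G) = relabel \<rho> G}
          {\<pi> \<in> perms n. relabel \<pi> G = relabel \<rho> G}"
    using \<rho> inv_in_perms[OF \<rho>] perms_inv_comp[OF \<rho>]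
    by (intro bij_betwI[where g="\<lambda>\<pi>. \<pi> \<circ> inv \<rho>"])
       (auto simp: comp_in_perms relabel_comp o_assoc[symmetric])
  then show ?thesis using card_transporter[OF \<rho>] by (simp add: bij_betw_same_card)
qed

text \<open>
  Orbit-stabilizer in weighted form: grouping the permutations by the graph that they produce, each
  graph in the orbit \<open>struct n H\<close> occurs as often as \<open>H\<close> itself. Divided by \<open>n!\<close>, this is the
  probability that a \<open>p\<close>-distributed graph becomes \<open>H\<close> under a uniformly random relabeling.
\<close>

lemma sum_pmf_relabel:
  "(\<Sum>\<pi>\<in>perms n. pmf p (relabel \<pi> H))
     = card {\<pi> \<in> perms n. relabel \<pi> H = H} * measure (measure_pmf p) (struct n H)"
proof -
  let ?s = "card {\<pi> \<in> perms n. relabel \<pi> H = H}"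
  have struct: "struct n H = (\<lambda>\<pi>. relabel \<pi> H) ` perms n" by (auto simp: struct_def)
  have "(\<Sum>\<pi>\<in>perms n. pmf p (relabel \<pi> H))
      = (\<Sum>g\<in>struct n H. \<Sum>\<pi> | \<pi> \<in> perms n \<and> relabel \<pi> H = g. pmf p (relabel \<pi> H))"
    unfolding struct by (rule sum.image_gen) simp
  also have "\<dots> = (\<Sum>g\<in>struct n H. ?s * pmf p g)"
  proof (rule sum.cong[OF refl])
    fix g assume "g \<in> struct n H"
    then have "card {\<pi> \<in> perms n. relabel \<pi> H = g} = ?s"
      unfolding struct using card_transporter by blast
    moreover have "(\<Sum>\<pi> | \<pi> \<in> perms n \<and> relabel \<pi> H = g. pmf p (relabel \<pi> H))
        = (\<Sum>\<pi> | \<pi> \<in> perms n \<and> relabel \<pi> H = g. pmf p g)"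
      by (intro sum.cong) auto
    ultimately show "(\<Sum>\<pi> | \<pi> \<in> perms n \<and> relabel \<pi> H = g. pmf p (relabel \<pi> H)) = ?s * pmf p g"
      by simp
  qed
  also have "\<dots> = ?s * measure (measure_pmf p) (struct n H)"
    by (simp add: struct measure_measure_pmf_finite sum_distrib_left)
  finally show ?thesis .
qed

section \<open>The preferential attachment graph\<close>

text \<open>
  By \<open>PA_support\<close> the degrees of the old graph have a positive sum. The choice of a neighbor is
  then governed by the intended distribution on \<open>{1..Suc n}\<close>, so finitely many lists of choices
  are possible.
\<close>

lemma finite_set_PA:
  assumes "m \<ge> 1"
  shows "finite (set_pmf (PA m n))"
  using assms
proof (induction m n rule: PA.induct)
  case (3 m n)
  have "finite (set_pmf (replicate_pmf m (choice_pmf (Suc n) G)))" if "G \<in> set_pmf (PA m (Suc n))" for G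
  proof -
    have "(\<Sum>u\<in>{1..Suc n}. deg G u) > 0"
      using PA_support[OF "3.prems" _ that] "3.prems" by simp
    from pmf_choice_pmf[OF this] have "set_pmf (choice_pmf (Suc n) G) \<subseteq> {1..Suc n}"
      by (auto simp: set_pmf_iff split: if_splits)
    then have "finite (set_pmf (choice_pmf (Suc n) G))" by (rule finite_subset) simp
    then show ?thesis
      using finite_lists_length_eq[of "set_pmf (choice_pmf (Suc n) G)" m]
      by (simp add: set_replicate_pmf lists_eq_set)
  qed
  with 3 show ?case by simp
qed simp_all

section \<open>The structural entropy identity\<close>

theorem lemma1:
  fixes M :: "'a measure" and b :: real and m n :: nat
    and G :: "'a \<Rightarrow> multigraph" and \<sigma> :: "'a \<Rightarrow> nat \<Rightarrow> nat"
  assumes "prob_space M" and "b > 1" and "m \<ge> 1" and "n \<ge> 1"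
    and "G \<in> measurable M (count_space UNIV)"
    and "distr M (count_space UNIV) G = measure_pmf (PA m n)"
    and "\<sigma> \<in> measurable M (count_space (perms n))"
    and "distr M (count_space (perms n)) \<sigma> = uniform_count_measure (perms n)"
    and "prob_space.indep_set M
           (sets (vimage_algebra (space M) G (count_space UNIV)))
           (sets (vimage_algebra (space M) \<sigma> (count_space (perms n))))"
  shows "prob_space.entropy M b (count_space UNIV) G
           - prob_space.entropy M b (count_space (range (struct n))) (\<lambda>\<omega>. struct n (G \<omega>))
         = prob_space.conditional_entropy M b (count_space (perms n)) (count_space UNIV)
             \<sigma> (\<lambda>\<omega>. relabel (\<sigma> \<omega>) (G \<omega>))
           - prob_space.expectation M (\<lambda>\<omega>. log b (real (card (Aut n (G \<omega>)))))"
proof -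
  interpret prob_space M by fact
  note G = assms(5) and \<sigma> = assms(7)
  define p where "p = PA m n"
  let ?GS = "\<lambda>\<omega>. relabel (\<sigma> \<omega>) (G \<omega>)"
  have perms: "\<sigma> \<omega> \<in> perms n" if "\<omega> \<in> space M" for \<omega>
    using measurable_space[OF \<sigma> that] by simp

  have countable: "countable (perms n)" "countable (UNIV :: multigraph set)"
      "countable (range (struct n))"
    using countable_multigraphs by (auto intro: countable_finite)
  have \<sigma>G: "(\<lambda>\<omega>. (\<sigma> \<omega>, G \<omega>)) \<in> measurable M (count_space (perms n \<times> UNIV))"
    using measurable_Pair[OF \<sigma> G] by (simp add: pair_measure_countable countable)
  have GS: "?GS \<in> measurable M (count_space UNIV)"
    using measurable_compose[OF \<sigma>G, of "\<lambda>(\<pi>, g). relabel \<pi> g" "count_space UNIV"] by simp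
  have struct_G: "(\<lambda>\<omega>. struct n (G \<omega>)) \<in> measurable M (count_space (range (struct n)))"
    using measurable_compose[OF G, of "struct n"] by simp

  have prob_G: "prob (G -` A \<inter> space M) = measure (measure_pmf p) A" for A
    using measure_distr[OF G, of A] assms(6) by (simp add: p_def)
  have prob_\<sigma>: "prob (\<sigma> -` {\<pi>} \<inter> space M) = 1 / fact n" if "\<pi> \<in> perms n" for \<pi>
    using measure_distr[OF \<sigma>, of "{\<pi>}"] assms(8) that
    by (simp add: measure_uniform_count_measure card_perms)
  have prob_\<sigma>G: "prob ((\<lambda>\<omega>. (\<sigma> \<omega>, G \<omega>)) -` {(\<pi>, g)} \<inter> space M) = pmf p g / fact n"
    if "\<pi> \<in> perms n" for \<pi> g
  proof -
    have "(\<lambda>\<omega>. (\<sigma> \<omega>, G \<omega>)) -` {(\<pi>, g)} \<inter> space M = (G -` {g} \<inter> space M) \<inter> (\<sigma> -` {\<pi>} \<inter> space M)"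
      by auto
    also have "prob \<dots> = prob (G -` {g} \<inter> space M) * prob (\<sigma> -` {\<pi>} \<inter> space M)"
      using that by (intro indep_setD[OF assms(9)]) (auto intro!: in_vimage_algebra)
    finally show ?thesis by (simp add: prob_G prob_\<sigma>[OF that] measure_pmf_single)
  qed
  have prob_\<sigma>GS: "prob ((\<lambda>\<omega>. (\<sigma> \<omega>, ?GS \<omega>)) -` {(\<pi>, relabel \<pi> g)} \<inter> space M) = pmf p g / fact n"
    if "\<pi> \<in> perms n" for \<pi> g
  proof -
    have "(\<lambda>\<omega>. (\<sigma> \<omega>, ?GS \<omega>)) -` {(\<pi>, relabel \<pi> g)} \<inter> space M
        = (\<lambda>\<omega>. (\<sigma> \<omega>, G \<omega>)) -` {(\<pi>, g)} \<inter> space M"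
      using relabel_eq_iff[OF that] by (auto simp: relabel_comp perms_inv_comp[OF perms])
    then show ?thesis using prob_\<sigma>G[OF that] by simp
  qed
  have prob_GS: "prob (?GS -` {h} \<inter> space M)
      = card {\<pi> \<in> perms n. relabel \<pi> h = h} * measure (measure_pmf p) (struct n h) / fact n" for h
  proof -
    have "?GS -` {h} \<inter> space M
        = (\<Union>\<pi>\<in>perms n. (\<lambda>\<omega>. (\<sigma> \<omega>, G \<omega>)) -` {(\<pi>, relabel (inv \<pi>) h)} \<inter> space M)"
      using perms by (auto simp: relabel_comp perms_inv_comp[OF perms])
    \<comment> \<open>The permutation drawn determines which graph must have been its argument.\<close>
    also have "prob \<dots> = (\<Sum>\<pi>\<in>perms n.
        prob ((\<lambda>\<omega>. (\<sigma> \<omega>, G \<omega>)) -` {(\<pi>, relabel (inv \<pi>) h)} \<inter> space M))"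
      by (rule finite_measure_finite_Union)
         (auto simp: disjoint_family_on_def intro!: measurable_sets[OF \<sigma>G])
    also have "\<dots> = (\<Sum>\<pi>\<in>perms n. pmf p (relabel (inv \<pi>) h) / fact n)"
      by (intro sum.cong refl prob_\<sigma>G)
    also have "\<dots> = (\<Sum>\<pi>\<in>perms n. pmf p (relabel \<pi> h)) / fact n"
      using sum_permutations_inverse[of "\<lambda>\<pi>. pmf p (relabel \<pi> h)" "{1..n}"]
      by (simp add: perms_def sum_divide_distrib)
    finally show ?thesis by (simp add: sum_pmf_relabel)
  qed

  have AE_G: "AE \<omega> in M. G \<omega> \<in> set_pmf p"
    by (rule AE_distrD[OF G]) (unfold assms(6) p_def, rule AE_measure_pmf)
  have fin: "finite (set_pmf p)" using assms(3) by (simp add: p_def finite_set_PA)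

  let ?LG = "\<lambda>\<omega>. log b (pmf p (G \<omega>))"
  let ?LS = "\<lambda>\<omega>. log b (measure (measure_pmf p) (struct n (G \<omega>)))"
  let ?LA = "\<lambda>\<omega>. log b (real (card (Aut n (G \<omega>))))"
  let ?LC = "\<lambda>\<omega>. log b (prob ((\<lambda>\<omega>'. (\<sigma> \<omega>', ?GS \<omega>')) -` {(\<sigma> \<omega>, ?GS \<omega>)} \<inter> space M)
                    / prob (?GS -` {?GS \<omega>} \<inter> space M))"
  have int: "integrable M (\<lambda>\<omega>. f (G \<omega>))" for f :: "multigraph \<Rightarrow> real"
    by (rule integrable_finite_range_AE[OF G fin AE_G])

  have H_G: "entropy b (count_space UNIV) G = - expectation ?LG"
    by (subst entropy_count_space[OF countable(2) G]) (simp add: prob_G measure_pmf_single)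
  have "(\<lambda>\<omega>. struct n (G \<omega>)) -` {struct n g} = G -` struct n g" for g
    by (auto simp: struct_eq_iff)
  then have H_S: "entropy b (count_space (range (struct n))) (\<lambda>\<omega>. struct n (G \<omega>)) = - expectation ?LS"
    by (subst entropy_count_space[OF countable(3) struct_G]) (simp add: prob_G)
  have H_C: "conditional_entropy b (count_space (perms n)) (count_space UNIV) \<sigma> ?GS
      = - expectation ?LC"
    by (rule conditional_entropy_count_space[OF countable(1) \<sigma> countable(2) GS])

  have "AE \<omega> in M. ?LC \<omega> = ?LG \<omega> - ?LS \<omega> - ?LA \<omega>"
    using AE_G AE_space
  proof eventually_elim
    case (elim \<omega>)
    let ?g = "G \<omega>"
    have \<pi>: "\<sigma> \<omega> \<in> perms n" by (rule perms) fact
    have "\<forall>e\<in>#?g. set_uprod e \<subseteq> {1..n}"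
      using PA_support assms(3,4) elim(1) unfolding p_def by blast
    then have Aut: "Aut n ?g = {\<pi> \<in> perms n. relabel \<pi> ?g = ?g}" by (rule Aut_eq_stabilizer)
    have Aut_pos: "card (Aut n ?g) > 0"
      unfolding Aut card_gt_0_iff using id_in_perms relabel_id by (auto intro!: exI[of _ id])
    have pmf_pos: "pmf p ?g > 0" using elim(1) by (simp add: pmf_positive)
    also have "pmf p ?g \<le> measure (measure_pmf p) (struct n ?g)"
      unfolding measure_pmf_single[symmetric] using self_in_struct
      by (intro measure_pmf.finite_measure_mono) auto
    finally have struct_pos: "measure (measure_pmf p) (struct n ?g) > 0" .
    have "?LC \<omega> = log b ((pmf p ?g / fact n) / (card (Aut n ?g) * measure (measure_pmf p) (struct n ?g) / fact n))"
      using \<pi> by (simp add: prob_\<sigma>GS prob_GS card_stabilizer_relabel struct_relabel Aut)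
    also have "\<dots> = log b (pmf p ?g / (card (Aut n ?g) * measure (measure_pmf p) (struct n ?g)))"
      by simp
    also have "\<dots> = ?LG \<omega> - ?LS \<omega> - ?LA \<omega>"
      using pmf_pos struct_pos Aut_pos assms(2) by (simp add: log_divide log_mult)
    finally show ?case .
  qed
  \<comment> \<open>\<open>?LC\<close> is a function of the discrete random variable \<open>(\<sigma>, G)\<close>.\<close>
  moreover have "?LC \<in> borel_measurable M"
    using measurable_compose[OF \<sigma>G, of "\<lambda>(\<pi>, g). log b
        (prob ((\<lambda>\<omega>'. (\<sigma> \<omega>', ?GS \<omega>')) -` {(\<pi>, relabel \<pi> g)} \<inter> space M)
          / prob (?GS -` {relabel \<pi> g} \<inter> space M))" borel] by simp
  ultimately have "expectation ?LC = expectation (\<lambda>\<omega>. ?LG \<omega> - ?LS \<omega> - ?LA \<omega>)"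
    using int by (intro integral_cong_AE) (auto intro!: borel_measurable_integrable)
  also have "\<dots> = expectation ?LG - expectation ?LS - expectation ?LA"
    using int[of "\<lambda>g. log b (pmf p g)"] int[of "\<lambda>g. log b (measure (measure_pmf p) (struct n g))"]
      int[of "\<lambda>g. log b (real (card (Aut n g)))"] by simp
  finally show ?thesis unfolding H_G H_S H_C by simp
qed

end
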